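(* Let $\Omega=\mathbb{R}$, let $f\colon\mathbb{R}\to\mathbb{R}_+$ be a positive convex function with $f(1)=0$, and let $p,q\in\mathcal{P}(\Omega)$. Denote $\hat f(u)=f(\frac{1}{u})$, and denote by $\hat f^*$ the conjugate function of $\hat f$, with $\hat f^*(v)=\sup_{u\in\mathbb{R}}\{uv-\hat f(u)\}$. Assume $\hat f$ is strictly convex with respect to the variable $u$. Then the transport $f$-divergence satisfies $$\mathrm{D}_{\mathrm{T},f}(p\|q)=\sup_{\Psi}\ \int_\Omega\Psi(x)\,p(T(x))\,dx-\int_\Omega\hat f^*(\Psi(x))\,q(x)\,dx ,$$ where the supremum is over all continuous functions $\Psi\in C(\Omega;\mathbb{R})$, and $T$ is the monotone mapping function such that $T_\#q=p$. The optimality condition of this supremum problem is the following. Denote the transport $f$-duality variable $$\Psi_{\mathrm{opt}}(x):=\hat f'\Big(\frac{1}{T'(x)}\Big).$$ Then $$\mathrm{D}_{\mathrm{T},f}(p\|q)=\int_\Omega\Psi_{\mathrm{opt}}(x)\,p(T(x))\,dx-\int_\Omega\hat f^*(\Psi_{\mathrm{opt}}(x))\,q(x)\,dx .$$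
   Context: $\mathcal{P}(\Omega)=\{p\in C^\infty(\Omega):\int_\Omega p(x)\,dx=1,\ p(x)>0\}$ is the space of smooth positive probability density functions on $\Omega$. For $p,q\in\mathcal{P}(\Omega)$, the monotone mapping function $T$ with $T_\#q=p$ (push-forward of $q$ to $p$) is $T(x)=F_p^{-1}(F_q(x))$, where $F_p,F_q$ are the cumulative distribution functions of $p,q$; it satisfies $p(T(x))\,T'(x)=q(x)$. Definition (transport $f$-divergence): $$\mathrm{D}_{\mathrm{T},f}(p\|q)=\int_\Omega f\Big(\frac{q(x)}{p(T(x))}\Big)q(x)\,dx .$$
   Formalization: f is convex and nonnegative on (0,∞) only, with f̂=+∞ for u≤0; the supremum is over continuous Ψ whose objective is not undefined (∞−∞); the last identity assumes f̂ is differentiable at each 1/T'(x) and that its right-hand side is not undefined. *)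

theory Defs
  imports "HOL-Probability.Probability"
begin

definition smooth_pos_densities :: "(real \<Rightarrow> real) set" where
  "smooth_pos_densities =
     {p. (\<forall>n. ((deriv ^^ n) p) differentiable_on UNIV) \<and> (\<forall>x. 0 < p x) \<and>
         integrable lborel p \<and> (LINT x|lborel. p x) = 1}"

definition density_cdf :: "(real \<Rightarrow> real) \<Rightarrow> real \<Rightarrow> real" where
  "density_cdf p = cdf (density lborel (\<lambda>x. ennreal (p x)))"

(* For a positive density p, density_cdf p is injective with range {0<..<1}, so the choice
   made by inv is forced. *)
definition transport_map :: "(real \<Rightarrow> real) \<Rightarrow> (real \<Rightarrow> real) \<Rightarrow> real \<Rightarrow> real" where
  "transport_map p q x = inv (density_cdf p) (density_cdf q x)"

(* The Lebesgue integral with values in [-\<infinity>, \<infinity>]: e2ennreal maps negative numbers to 0, so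
   this is the integral of the positive part minus the integral of the negative part. It is
   meaningful when ext_integral_exists holds; note that \<infinity> - \<infinity> = \<infinity> in type ereal. *)
definition ext_integral :: "'a measure \<Rightarrow> ('a \<Rightarrow> ereal) \<Rightarrow> ereal" where
  "ext_integral M g =
     enn2ereal (\<integral>\<^sup>+x. e2ennreal (g x) \<partial>M) - enn2ereal (\<integral>\<^sup>+x. e2ennreal (- g x) \<partial>M)"

definition ext_integral_exists :: "'a measure \<Rightarrow> ('a \<Rightarrow> ereal) \<Rightarrow> bool" where
  "ext_integral_exists M g \<longleftrightarrow>
     (\<integral>\<^sup>+x. e2ennreal (g x) \<partial>M) < \<infinity> \<or> (\<integral>\<^sup>+x. e2ennreal (- g x) \<partial>M) < \<infinity>"

definition transport_f_divergence ::
    "(real \<Rightarrow> real) \<Rightarrow> (real \<Rightarrow> real) \<Rightarrow> (real \<Rightarrow> real) \<Rightarrow> ereal" where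
  "transport_f_divergence f p q =
     ext_integral lborel (\<lambda>x. ereal (f (q x / p (transport_map p q x)) * q x))"

definition strictly_convex_on :: "real set \<Rightarrow> (real \<Rightarrow> real) \<Rightarrow> bool" where
  "strictly_convex_on S g \<longleftrightarrow> convex S \<and>
     (\<forall>x\<in>S. \<forall>y\<in>S. x \<noteq> y \<longrightarrow> (\<forall>t. 0 < t \<and> t < 1 \<longrightarrow>
        g ((1 - t) * x + t * y) < (1 - t) * g x + t * g y))"

definition fhat :: "(real \<Rightarrow> real) \<Rightarrow> real \<Rightarrow> real" where
  "fhat f u = f (1 / u)"

(* Only the values of a generator on the open half-line are used. As a convex function on the
   whole line it is +\<infinity> elsewhere, so that conjugates may be taken over all real u. *)
definition ext_by_infinity :: "(real \<Rightarrow> real) \<Rightarrow> real \<Rightarrow> ereal" where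
  "ext_by_infinity g u = (if 0 < u then ereal (g u) else \<infinity>)"

definition conjugate :: "(real \<Rightarrow> ereal) \<Rightarrow> real \<Rightarrow> ereal" where
  "conjugate g v = (SUP u. ereal (u * v) - g u)"

definition fhat_conj :: "(real \<Rightarrow> real) \<Rightarrow> real \<Rightarrow> ereal" where
  "fhat_conj f = conjugate (ext_by_infinity (fhat f))"

definition primal_term ::
    "(real \<Rightarrow> real) \<Rightarrow> (real \<Rightarrow> real) \<Rightarrow> (real \<Rightarrow> real) \<Rightarrow> real \<Rightarrow> ereal" where
  "primal_term p q \<Psi> x = ereal (\<Psi> x * p (transport_map p q x))"

definition conj_term ::
    "(real \<Rightarrow> real) \<Rightarrow> (real \<Rightarrow> real) \<Rightarrow> (real \<Rightarrow> real) \<Rightarrow> real \<Rightarrow> ereal" where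
  "conj_term f q \<Psi> x = fhat_conj f (\<Psi> x) * ereal (q x)"

definition dual_objective ::
    "(real \<Rightarrow> real) \<Rightarrow> (real \<Rightarrow> real) \<Rightarrow> (real \<Rightarrow> real) \<Rightarrow> (real \<Rightarrow> real) \<Rightarrow> ereal" where
  "dual_objective f p q \<Psi> =
     ext_integral lborel (primal_term p q \<Psi>) - ext_integral lborel (conj_term f q \<Psi>)"

(* Both integrals of dual_objective exist in [-\<infinity>, \<infinity>] and their difference is neither
   \<infinity> - \<infinity> nor (-\<infinity>) - (-\<infinity>). *)
definition dual_well_defined ::
    "(real \<Rightarrow> real) \<Rightarrow> (real \<Rightarrow> real) \<Rightarrow> (real \<Rightarrow> real) \<Rightarrow> (real \<Rightarrow> real) \<Rightarrow> bool" where
  "dual_well_defined f p q \<Psi> \<longleftrightarrow>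
     ext_integral_exists lborel (primal_term p q \<Psi>) \<and>
     ext_integral_exists lborel (conj_term f q \<Psi>) \<and>
     \<not> (ext_integral lborel (primal_term p q \<Psi>) = \<infinity> \<and>
        ext_integral lborel (conj_term f q \<Psi>) = \<infinity>) \<and>
     \<not> (ext_integral lborel (primal_term p q \<Psi>) = - \<infinity> \<and>
        ext_integral lborel (conj_term f q \<Psi>) = - \<infinity>)"

definition duality_variable ::
    "(real \<Rightarrow> real) \<Rightarrow> (real \<Rightarrow> real) \<Rightarrow> (real \<Rightarrow> real) \<Rightarrow> real \<Rightarrow> real" where
  "duality_variable f p q x = deriv (fhat f) (1 / deriv (transport_map p q) x)"

end

(* With w = p(T)/q = 1/T' and g the convex function u -> f(1/u), the divergence is the integral of
   g(w) q. Integrating the Fenchel-Young inequality v w <= g(w) + g*(v) against q gives weak duality;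
   it is an equality at v = g'(w), hence the optimality of the duality variable.
   Since g need not be differentiable, the supremum is approached by replacing g'(w) with the
   continuous chord slope (g(w + d) - g(w))/d, which is an almost subgradient uniformly on compact
   sets, and multiplying it by a compactly supported cutoff. *)
theory Submission
  imports Defs
begin

text \<open>Nothing is assumed integrable: the divergence may be \<infinity>, and the dual objective
  may be undefined at the formal optimizer. The near-optimizers therefore have to be built so that
  both of their integrals are finite. The normalization permits this. Since \<open>g \<ge> 0\<close>
  and \<open>g 1 = 0\<close>, the conjugate vanishes at 0, so a compactly supported \<Psi>
  contributes nothing off its support; the choice \<open>u = 1\<close> in the supremum also gives
  \<open>g*(v) \<ge> v\<close>, which bounds the conjugate term from below. Each such \<Psi>
  recovers the divergence only over a bounded interval, and monotone convergence over growing
  intervals covers finite and infinite divergence alike. A subgradient selection in place of chord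
  slopes may jump at the kinks of \<open>g\<close>, while \<Psi> must be continuous. Chords to the
  right are always available, because \<open>w + d\<close> stays in the half-line.\<close>

section \<open>Conjugates and derivatives of convex functions on the half-line\<close>

lemma strictly_convex_on_imp_convex_on:
  assumes "strictly_convex_on S g"
  shows "convex_on S g"
proof (rule convex_onI)
  show "convex S" using assms by (simp add: strictly_convex_on_def)
  fix t x y :: real
  assume "0 < t" "t < 1" "x \<in> S" "y \<in> S"
  then show "g ((1 - t) *\<^sub>R x + t *\<^sub>R y) \<le> (1 - t) * g x + t * g y"
    using assms unfolding strictly_convex_on_def real_scaleR_def
    by (cases "x = y") (simp add: algebra_simps, meson less_imp_le)
qed

lemma conjugate_ext_upper:
  assumes "0 < u"
  shows "ereal (u * v - g u) \<le> conjugate (ext_by_infinity g) v"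
  unfolding conjugate_def
  by (rule SUP_upper2[of u]) (use assms in \<open>auto simp: ext_by_infinity_def\<close>)

lemma conjugate_ext_least:
  assumes "\<And>u. 0 < u \<Longrightarrow> u * v - g u \<le> c"
  shows "conjugate (ext_by_infinity g) v \<le> ereal c"
  unfolding conjugate_def
  by (rule SUP_least) (use assms in \<open>auto simp: ext_by_infinity_def\<close>)

text \<open>The supremum runs over uncountably many affine functions, so measurability comes from
  lower semicontinuity: every strict superlevel set is a union of open sets.\<close>

lemma borel_measurable_conjugate [measurable]:
  "conjugate (ext_by_infinity g) \<in> borel_measurable borel"
proof (rule borel_measurableI_greater)
  fix y :: ereal
  have "{v. y < conjugate (ext_by_infinity g) v} = (\<Union>u\<in>{0<..}. {v. y < ereal (u * v - g u)})"
    (is "?L = ?R")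
  proof
    show "?R \<subseteq> ?L" using conjugate_ext_upper less_le_trans by fastforce
    show "?L \<subseteq> ?R"
      by (auto simp: conjugate_def less_SUP_iff ext_by_infinity_def split: if_splits)
  qed
  moreover have "open ?R"
    by (intro open_UN ballI open_Collect_less continuous_intros)
  ultimately show "{v \<in> space borel. y < conjugate (ext_by_infinity g) v} \<in> sets borel"
    by simp
qed

text \<open>Chord slopes, unlike subgradients, depend continuously on the base point; the price is an
  error bounded by the oscillation of \<open>g\<close> along the chord.\<close>

lemma conjugate_chord_slope:
  fixes g :: "real \<Rightarrow> real"
  assumes g: "convex_on {0<..} g" and w: "0 < w" and d: "0 < d"
    and e: "\<And>u. w \<le> u \<Longrightarrow> u \<le> w + d \<Longrightarrow> g w \<le> g u + e \<and> g (w + d) \<le> g u + e"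
  shows "conjugate (ext_by_infinity g) ((g (w + d) - g w) / d)
           \<le> ereal ((g (w + d) - g w) / d * w - g w + e)"
proof (rule conjugate_ext_least)
  fix u :: real assume u: "0 < u"
  define s where "s = (g (w + d) - g w) / d"
  have e0: "0 \<le> e" using e[of w] d by simp
  have "g w + s * (u - w) \<le> g u + e"
  proof -
    \<comment> \<open>Outside the interval spanned by the chord, convexity puts \<open>g\<close>
      above the extended secant without loss. Only between the endpoints is \<open>g\<close> below
      the secant, and only there is \<open>e\<close> spent.\<close>
    consider "u < w" | "w \<le> u" "u \<le> w + d" | "w + d < u" by linarith
    then show ?thesis
    proof cases
      case 1
      have "(g u - g w) / (u - w) \<le> (g w - g (w + d)) / (w - (w + d))"
        using convex_on_slope_le[OF g, of u "w + d" w] 1 w d u by simp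
      also have "\<dots> = s" using d by (simp add: s_def field_simps)
      finally have "s * (u - w) \<le> g u - g w" using 1 by (simp add: field_simps)
      then show ?thesis using e0 by simp
    next
      case 2
      define t where "t = (u - w) / d"
      have t: "0 \<le> t" "t \<le> 1" using 2 d by (auto simp: t_def field_simps)
      have "g w + s * (u - w) = (1 - t) * g w + t * g (w + d)"
        using d by (simp add: s_def t_def field_simps)
      also have "\<dots> \<le> (1 - t) * (g u + e) + t * (g u + e)"
        using e[OF 2] t by (intro add_mono mult_left_mono) auto
      finally show ?thesis by (simp add: algebra_simps)
    next
      case 3
      have "(g w - g (w + d)) / (w - (w + d)) \<le> (g w - g u) / (w - u)"
        using convex_on_slope_le(1)[OF g, of w u "w + d"] 3 w d u by simp
      moreover have "(g w - g (w + d)) / (w - (w + d)) = s" using d by (simp add: s_def field_simps)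
      moreover have "(g w - g u) / (w - u) = (g u - g w) / (u - w)"
        by (metis minus_diff_eq minus_divide_divide)
      ultimately have "s \<le> (g u - g w) / (u - w)" by simp
      then have "s * (u - w) \<le> g u - g w" using 3 d by (simp add: pos_le_divide_eq)
      then show ?thesis using e0 by simp
    qed
  qed
  then show "u * ((g (w + d) - g w) / d) - g u \<le> (g (w + d) - g w) / d * w - g w + e"
    unfolding s_def[symmetric] by (simp add: algebra_simps)
qed

text \<open>As \<open>g\<close> is nonnegative, \<open>c * g u \<le> g u\<close>, so shrinking the
  slope by \<open>c\<close> shrinks any bound on the conjugate by \<open>c\<close>. The factor
  \<open>c\<close> will be the value of the cutoff.\<close>

lemma conjugate_scale:
  assumes g0: "\<And>u. 0 < u \<Longrightarrow> 0 \<le> g u" and c: "0 \<le> c" "c \<le> 1"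
    and k: "conjugate (ext_by_infinity g) s \<le> ereal k"
  shows "conjugate (ext_by_infinity g) (c * s) \<le> ereal (c * k)"
proof (rule conjugate_ext_least)
  fix u :: real assume u: "0 < u"
  have "u * s - g u \<le> k" using conjugate_ext_upper[OF u] k order_trans ereal_less_eq(3) by blast
  then have "c * (u * s - g u) \<le> c * k" using c by (intro mult_left_mono)
  moreover have "c * g u \<le> g u" using g0[OF u] c by (simp add: mult_left_le_one_le)
  ultimately show "u * (c * s) - g u \<le> c * k" by (simp add: algebra_simps)
qed

lemma convex_on_pos_above_tangent:
  fixes g :: "real \<Rightarrow> real"
  assumes g: "convex_on {0<..} g" and u: "0 < u" "g differentiable (at u)" and v: "0 < v"
  shows "deriv g u * (v - u) \<le> g v - g u"
proof (rule convex_on_imp_above_tangent[OF g])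
  show "(g has_real_derivative deriv g u) (at u within {0<..})"
    using u(2) DERIV_deriv_iff_real_differentiable has_field_derivative_at_within by blast
qed (use u v in \<open>auto simp: interior_open\<close>)

text \<open>Equality case of Fenchel-Young: the tangent at \<open>w\<close> supports
  \<open>g\<close>, so \<open>w\<close> itself attains the supremum.\<close>

lemma conjugate_at_deriv:
  fixes g :: "real \<Rightarrow> real"
  assumes "convex_on {0<..} g" "0 < w" "g differentiable (at w)"
  shows "conjugate (ext_by_infinity g) (deriv g w) = ereal (w * deriv g w - g w)"
proof (rule antisym)
  show "conjugate (ext_by_infinity g) (deriv g w) \<le> ereal (w * deriv g w - g w)"
  proof (rule conjugate_ext_least)
    fix u :: real assume "0 < u"
    then show "u * deriv g w - g u \<le> w * deriv g w - g w"
      using convex_on_pos_above_tangent[OF assms, of u] by (simp add: algebra_simps)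
  qed
qed (rule conjugate_ext_upper[OF assms(2)])

text \<open>By convexity the derivative at \<open>u\<close> lies above the slopes of chords to the
  left and below those to the right. For fixed \<open>h\<close> such a slope is continuous in
  \<open>u\<close>, so a chord at \<open>u0\<close> that is good enough controls the derivative at
  nearby points from one side. The set \<open>S\<close> is arbitrary because differentiability will
  be known only at the values of \<open>1 / T'\<close>.\<close>

lemma convex_on_continuous_on_deriv:
  fixes g :: "real \<Rightarrow> real"
  assumes g: "convex_on {0<..} g" and S: "S \<subseteq> {0<..}"
    and diff: "\<And>u. u \<in> S \<Longrightarrow> g differentiable (at u)"
  shows "continuous_on S (deriv g)"
  unfolding continuous_on_def
proof
  fix u0 assume u0: "u0 \<in> S"
  then have pos: "0 < u0" using S by auto
  have cont: "isCont g u" if "0 < u" for u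
    using convex_on_continuous[OF _ g] that by (simp add: continuous_on_eq_continuous_at)
  have slope: "((\<lambda>h. (g (u0 + h) - g u0) / h) \<longlongrightarrow> deriv g u0) (at 0)"
    using diff[OF u0] DERIV_deriv_iff_real_differentiable DERIV_D by blast
  have slope_cont: "((\<lambda>u. (g (u + h) - g u) / h) \<longlongrightarrow> (g (u0 + h) - g u0) / h) (at u0 within S)"
    and ev_pos: "\<forall>\<^sub>F u in at u0 within S. u \<in> S \<and> 0 < u + h" if h: "h \<noteq> 0" "0 < u0 + h" for h
  proof -
    have "isCont (\<lambda>u. g (u + h)) u0"
      using cont[OF h(2)] by (intro isCont_o2[where g=g and f="\<lambda>u. u + h"] continuous_intros)
    then have "isCont (\<lambda>u. (g (u + h) - g u) / h) u0" using cont[OF pos] h by (intro continuous_intros) auto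
    then show "((\<lambda>u. (g (u + h) - g u) / h) \<longlongrightarrow> (g (u0 + h) - g u0) / h) (at u0 within S)"
      unfolding isCont_def by (rule tendsto_within_subset) simp
    have "((\<lambda>u. u + h) \<longlongrightarrow> u0 + h) (at u0 within S)" by (intro tendsto_intros)
    then have "\<forall>\<^sub>F u in at u0 within S. 0 < u + h" using h(2) by (rule order_tendstoD)
    moreover have "\<forall>\<^sub>F u in at u0 within S. u \<in> S" by (simp add: eventually_at_filter)
    ultimately show "\<forall>\<^sub>F u in at u0 within S. u \<in> S \<and> 0 < u + h" by eventually_elim simp
  qed
  show "(deriv g \<longlongrightarrow> deriv g u0) (at u0 within S)"
  proof (rule order_tendstoI)
    fix a assume "a < deriv g u0"
    then have "\<forall>\<^sub>F h in at_left 0. a < (g (u0 + h) - g u0) / h"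
      using order_tendstoD(1)[OF slope] by (auto simp: eventually_at_split)
    \<comment> \<open>The lower limit \<open>-u0\<close> keeps \<open>u0 + h\<close> in the
      half-line.\<close>
    moreover have "\<forall>\<^sub>F h in at_left 0. h \<in> {-u0<..<0::real}"
      using pos by (intro eventually_at_leftI) auto
    ultimately have "\<forall>\<^sub>F h in at_left 0. a < (g (u0 + h) - g u0) / h \<and> h \<in> {-u0<..<0}"
      by eventually_elim auto
    then obtain h where h: "a < (g (u0 + h) - g u0) / h" "- u0 < h" "h < 0"
      using eventually_happens'[OF trivial_limit_at_left_real] by fastforce
    have "\<forall>\<^sub>F u in at u0 within S. a < (g (u + h) - g u) / h"
      using order_tendstoD(1)[OF slope_cont[of h]] h by auto
    moreover have "\<forall>\<^sub>F u in at u0 within S. u \<in> S \<and> 0 < u + h" using ev_pos[of h] h by auto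
    ultimately show "\<forall>\<^sub>F u in at u0 within S. a < deriv g u"
    proof eventually_elim
      case (elim u)
      then have "deriv g u * h \<le> g (u + h) - g u"
        using convex_on_pos_above_tangent[OF g _ diff, of u "u + h"] S by auto
      then have "(g (u + h) - g u) / h \<le> deriv g u" using h by (simp add: field_simps)
      then show ?case using elim by simp
    qed
  next
    fix a assume "deriv g u0 < a"
    then have "\<forall>\<^sub>F h in at_right 0. (g (u0 + h) - g u0) / h < a"
      using order_tendstoD(2)[OF slope] by (auto simp: eventually_at_split)
    moreover have "\<forall>\<^sub>F h in at_right 0. (0::real) < h" by (rule eventually_at_right_less)
    ultimately have "\<forall>\<^sub>F h in at_right 0. (g (u0 + h) - g u0) / h < a \<and> 0 < h"
      by eventually_elim auto
    then obtain h where h: "(g (u0 + h) - g u0) / h < a" "0 < h"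
      using eventually_happens'[OF trivial_limit_at_right_real] by fastforce
    have "\<forall>\<^sub>F u in at u0 within S. (g (u + h) - g u) / h < a"
      using order_tendstoD(2)[OF slope_cont[of h]] h pos by auto
    moreover have "\<forall>\<^sub>F u in at u0 within S. u \<in> S \<and> 0 < u + h" using ev_pos[of h] h pos by auto
    ultimately show "\<forall>\<^sub>F u in at u0 within S. deriv g u < a"
    proof eventually_elim
      case (elim u)
      then have "deriv g u * h \<le> g (u + h) - g u"
        using convex_on_pos_above_tangent[OF g _ diff, of u "u + h"] S by auto
      then have "deriv g u \<le> (g (u + h) - g u) / h" using h by (simp add: field_simps)
      then show ?case using elim by simp
    qed
  qed
qed

section \<open>Integrals with values in the extended reals\<close>

lemma ext_integral_nonneg:
  assumes "\<And>x. 0 \<le> g x"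
  shows "ext_integral M (\<lambda>x. ereal (g x)) = enn2ereal (\<integral>\<^sup>+x. ennreal (g x) \<partial>M)"
proof -
  have "e2ennreal (- ereal (g x)) = 0" for x using assms by (intro e2ennreal_neg) simp
  then show ?thesis by (simp add: ext_integral_def zero_ennreal.rep_eq)
qed

lemma
  assumes "integrable M g"
  shows ext_integral_integrable: "ext_integral M (\<lambda>x. ereal (g x)) = ereal (LINT x|M. g x)"
    and ext_integral_exists_integrable: "ext_integral_exists M (\<lambda>x. ereal (g x))"
proof -
  have fin: "(\<integral>\<^sup>+x. ennreal (g x) \<partial>M) \<noteq> top" "(\<integral>\<^sup>+x. ennreal (- g x) \<partial>M) \<noteq> top"
    using assms by (simp_all add: real_integrable_def)
  obtain a where a: "(\<integral>\<^sup>+x. ennreal (g x) \<partial>M) = ennreal a" "0 \<le> a"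
    using fin(1) by (cases "\<integral>\<^sup>+x. ennreal (g x) \<partial>M") auto
  obtain b where b: "(\<integral>\<^sup>+x. ennreal (- g x) \<partial>M) = ennreal b" "0 \<le> b"
    using fin(2) by (cases "\<integral>\<^sup>+x. ennreal (- g x) \<partial>M") auto
  have "(LINT x|M. g x) = a - b"
    using real_lebesgue_integral_def[OF assms] a b by simp
  then show "ext_integral M (\<lambda>x. ereal (g x)) = ereal (LINT x|M. g x)"
    using a b by (simp add: ext_integral_def)
  show "ext_integral_exists M (\<lambda>x. ereal (g x))"
    using fin by (simp add: ext_integral_exists_def less_top)
qed

lemma e2ennreal_parts_le:
  assumes "0 \<le> c" "b \<noteq> - \<infinity>" "ereal a \<le> ereal c + b"
  shows "e2ennreal (ereal a) + e2ennreal (- b) \<le> ennreal c + e2ennreal b + e2ennreal (- ereal a)"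
proof (cases b)
  case (real r)
  have "ennreal a + ennreal (- r) = ennreal (max 0 a + max 0 (-r))"
    by (simp add: ennreal_plus max_def ennreal_neg)
  also have "\<dots> \<le> ennreal (c + max 0 r + max 0 (-a))"
    using assms real by (intro ennreal_leI) (auto simp: max_def)
  also have "\<dots> = ennreal c + ennreal r + ennreal (- a)"
    using assms by (simp add: ennreal_plus max_def ennreal_neg)
  finally show ?thesis using real by simp
qed (use assms in auto)

lemma e2ennreal_parts_ge:
  assumes "0 \<le> c" "b \<noteq> - \<infinity>" "ereal c + b \<le> ereal a"
  shows "ennreal c + e2ennreal b + e2ennreal (- ereal a) \<le> e2ennreal (ereal a) + e2ennreal (- b)"
proof (cases b)
  case (real r)
  have "ennreal c + ennreal r + ennreal (- a) = ennreal (c + max 0 r + max 0 (-a))"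
    using assms by (simp add: ennreal_plus max_def ennreal_neg)
  also have "\<dots> \<le> ennreal (max 0 a + max 0 (-r))"
    using assms real by (intro ennreal_leI) (auto simp: max_def)
  also have "\<dots> = ennreal a + ennreal (- r)"
    by (simp add: ennreal_plus max_def ennreal_neg)
  finally show ?thesis using real by simp
qed (use assms in auto)

text \<open>Inequalities between \<open>a - a'\<close>, \<open>b - b'\<close> and \<open>c\<close> are written as ones between sums of
  nonnegative parts, so that they can be integrated without any finiteness assumption.\<close>

lemma enn2ereal_parts_diff_le:
  fixes a a' b b' c :: ennreal
  assumes "a + b' \<le> c + b + a'"
    and "a < \<infinity> \<or> a' < \<infinity>" "b < \<infinity> \<or> b' < \<infinity>"
    and "\<not> (enn2ereal a - enn2ereal a' = \<infinity> \<and> enn2ereal b - enn2ereal b' = \<infinity>)"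
    and "\<not> (enn2ereal a - enn2ereal a' = - \<infinity> \<and> enn2ereal b - enn2ereal b' = - \<infinity>)"
  shows "(enn2ereal a - enn2ereal a') - (enn2ereal b - enn2ereal b') \<le> enn2ereal c"
  using assms
  by (cases a; cases a'; cases b; cases b'; cases c)
     (auto simp flip: ennreal_plus simp: top_unique)

lemma enn2ereal_parts_diff_ge:
  fixes a a' b b' c :: ennreal
  assumes "c + b + a' \<le> a + b'"
    and "a < \<infinity> \<or> a' < \<infinity>" "b < \<infinity> \<or> b' < \<infinity>"
    and "\<not> (enn2ereal a - enn2ereal a' = \<infinity> \<and> enn2ereal b - enn2ereal b' = \<infinity>)"
    and "\<not> (enn2ereal a - enn2ereal a' = - \<infinity> \<and> enn2ereal b - enn2ereal b' = - \<infinity>)"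
  shows "enn2ereal c \<le> (enn2ereal a - enn2ereal a') - (enn2ereal b - enn2ereal b')"
  using assms
  by (cases a; cases a'; cases b; cases b'; cases c)
     (auto simp flip: ennreal_plus simp: top_unique)

context
  fixes M :: "'a measure" and a c :: "'a \<Rightarrow> real" and b :: "'a \<Rightarrow> ereal"
  assumes meas: "a \<in> borel_measurable M" "b \<in> borel_measurable M" "c \<in> borel_measurable M"
    and c: "\<And>x. 0 \<le> c x" and b: "\<And>x. b x \<noteq> - \<infinity>"
    and ex: "ext_integral_exists M (\<lambda>x. ereal (a x))" "ext_integral_exists M b"
    and undef: "\<not> (ext_integral M (\<lambda>x. ereal (a x)) = \<infinity> \<and> ext_integral M b = \<infinity>)"
      "\<not> (ext_integral M (\<lambda>x. ereal (a x)) = - \<infinity> \<and> ext_integral M b = - \<infinity>)"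
begin

text \<open>Meant for \<open>a\<close> the primal term, \<open>b\<close> the conjugate term and
  \<open>c\<close> the integrand of the divergence. The conditions \<open>undef\<close> exclude the
  two indeterminate differences, which type \<open>ereal\<close> evaluates to \<infinity> and which
  could break the bound.\<close>

lemma ext_integral_diff_le:
  assumes le: "\<And>x. ereal (a x) \<le> ereal (c x) + b x"
  shows "ext_integral M (\<lambda>x. ereal (a x)) - ext_integral M b \<le> ext_integral M (\<lambda>x. ereal (c x))"
proof -
  note [measurable] = meas
  have "(\<integral>\<^sup>+x. e2ennreal (ereal (a x)) + e2ennreal (- b x) \<partial>M)
      \<le> (\<integral>\<^sup>+x. ennreal (c x) + e2ennreal (b x) + e2ennreal (- ereal (a x)) \<partial>M)"
    by (intro nn_integral_mono e2ennreal_parts_le c b le)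
  then have "(\<integral>\<^sup>+x. e2ennreal (ereal (a x)) \<partial>M) + (\<integral>\<^sup>+x. e2ennreal (- b x) \<partial>M)
      \<le> (\<integral>\<^sup>+x. ennreal (c x) \<partial>M) + (\<integral>\<^sup>+x. e2ennreal (b x) \<partial>M) + (\<integral>\<^sup>+x. e2ennreal (- ereal (a x)) \<partial>M)"
    by (simp add: nn_integral_add del: e2ennreal_ereal)
  then show ?thesis
    using ex undef unfolding ext_integral_nonneg[OF c]
    unfolding ext_integral_exists_def ext_integral_def
    by (rule enn2ereal_parts_diff_le)
qed

lemma ext_integral_diff_ge:
  assumes le: "\<And>x. ereal (c x) + b x \<le> ereal (a x)"
  shows "ext_integral M (\<lambda>x. ereal (c x)) \<le> ext_integral M (\<lambda>x. ereal (a x)) - ext_integral M b"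
proof -
  note [measurable] = meas
  have "(\<integral>\<^sup>+x. ennreal (c x) + e2ennreal (b x) + e2ennreal (- ereal (a x)) \<partial>M)
      \<le> (\<integral>\<^sup>+x. e2ennreal (ereal (a x)) + e2ennreal (- b x) \<partial>M)"
    by (intro nn_integral_mono e2ennreal_parts_ge c b le)
  then have "(\<integral>\<^sup>+x. ennreal (c x) \<partial>M) + (\<integral>\<^sup>+x. e2ennreal (b x) \<partial>M) + (\<integral>\<^sup>+x. e2ennreal (- ereal (a x)) \<partial>M)
      \<le> (\<integral>\<^sup>+x. e2ennreal (ereal (a x)) \<partial>M) + (\<integral>\<^sup>+x. e2ennreal (- b x) \<partial>M)"
    by (simp add: nn_integral_add del: e2ennreal_ereal)
  then show ?thesis
    using ex undef unfolding ext_integral_nonneg[OF c]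
    unfolding ext_integral_exists_def ext_integral_def
    by (rule enn2ereal_parts_diff_ge)
qed

end

section \<open>Distribution functions and the monotone map\<close>

lemma smooth_pos_density_continuous_on:
  assumes "p \<in> smooth_pos_densities"
  shows "continuous_on UNIV p"
proof -
  have "((deriv ^^ 0) p) differentiable_on UNIV"
    using assms unfolding smooth_pos_densities_def by blast
  then show ?thesis by (simp add: differentiable_imp_continuous_on)
qed

lemma smooth_pos_density_real_distribution:
  assumes "p \<in> smooth_pos_densities"
  shows "real_distribution (density lborel (\<lambda>x. ennreal (p x)))"
proof -
  have "(\<integral>\<^sup>+x. ennreal (p x) \<partial>lborel) = ennreal (LINT x|lborel. p x)"
    using assms by (intro nn_integral_eq_integral) (auto simp: smooth_pos_densities_def less_imp_le)
  moreover have "p \<in> borel_measurable borel"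
    using assms by (auto simp: smooth_pos_densities_def)
  ultimately have "prob_space (density lborel (\<lambda>x. ennreal (p x)))"
    using assms by (intro prob_spaceI) (simp add: emeasure_density smooth_pos_densities_def)
  then show ?thesis
    by (simp add: real_distribution_def real_distribution_axioms_def)
qed

text \<open>Turns the measure-theoretic distribution function into an indefinite integral, ready for
  the fundamental theorem of calculus. The measure is that of a half-open interval; the missing
  endpoint is negligible.\<close>

lemma density_cdf_diff:
  assumes p: "p \<in> smooth_pos_densities" and ab: "a \<le> b"
  shows "density_cdf p b = density_cdf p a + integral {a..b} p"
proof (cases "a = b")
  case False
  interpret real_distribution "density lborel (\<lambda>x. ennreal (p x))"
    by (rule smooth_pos_density_real_distribution[OF p])
  have int: "integrable lborel p" and pos: "\<And>x. 0 < p x"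
    using p by (auto simp: smooth_pos_densities_def)
  have si: "set_integrable lborel S p" if "S \<in> sets borel" for S
    using integrable_mult_indicator[OF _ int] that by (simp add: set_integrable_def)
  have "measure (density lborel (\<lambda>x. ennreal (p x))) {a<..b} = (LINT x:{a<..b}|lborel. p x)"
  proof -
    have "emeasure (density lborel (\<lambda>x. ennreal (p x))) {a<..b}
        = (\<integral>\<^sup>+x. ennreal (indicator {a<..b} x *\<^sub>R p x) \<partial>lborel)"
      using int by (subst emeasure_density) (auto intro!: nn_integral_cong simp: indicator_def)
    also have "\<dots> = ennreal (LINT x:{a<..b}|lborel. p x)"
      unfolding set_lebesgue_integral_def
      using si[of "{a<..b}"] pos
      by (intro nn_integral_eq_integral) (auto simp: set_integrable_def less_imp_le)
    finally show ?thesis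
      using pos by (simp add: measure_def set_lebesgue_integral_def integral_nonneg less_imp_le)
  qed
  also have "\<dots> = integral {a<..b} p" using si by (intro set_borel_integral_eq_integral) auto
  also have "\<dots> = integral {a..b} p"
    by (rule integral_subset_negligible[OF _ negligible_subset[of "{a}"]]) auto
  finally show ?thesis
    using cdf_diff_eq[of a b] ab False by (simp add: density_cdf_def)
qed simp

lemma density_cdf_has_derivative:
  assumes p: "p \<in> smooth_pos_densities"
  shows "(density_cdf p has_real_derivative p x) (at x)"
proof -
  have "((\<lambda>y. integral {x - 1..y} p) has_real_derivative p x) (at x within {x - 1..x + 1})"
    using smooth_pos_density_continuous_on[OF p] continuous_on_subset
    by (intro integral_has_real_derivative) auto
  then have "((\<lambda>y. density_cdf p (x - 1) + integral {x - 1..y} p) has_real_derivative p x)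
      (at x within {x - 1..x + 1})"
    by (auto intro!: derivative_eq_intros)
  then have "(density_cdf p has_real_derivative p x) (at x within {x - 1..x + 1})"
    by (rule has_field_derivative_transform_within[where d=1])
       (auto intro!: density_cdf_diff[OF p, symmetric])
  moreover have "at x within {x - 1..x + 1} = at x" by (rule at_within_interior) simp
  ultimately show ?thesis by simp
qed

lemma density_cdf_strict_mono:
  assumes p: "p \<in> smooth_pos_densities" and "x < y"
  shows "density_cdf p x < density_cdf p y"
proof (rule DERIV_pos_imp_increasing[OF \<open>x < y\<close>])
  fix z
  have "0 < p z" using p by (simp add: smooth_pos_densities_def)
  then show "\<exists>d. (density_cdf p has_real_derivative d) (at z) \<and> 0 < d"
    using density_cdf_has_derivative[OF p] by blast
qed

text \<open>The range is the same for every density, so the values of \<open>density_cdf q\<close>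
  lie where \<open>inv (density_cdf p)\<close> is a genuine inverse.\<close>

lemma range_density_cdf:
  assumes p: "p \<in> smooth_pos_densities"
  shows "range (density_cdf p) = {0<..<1}"
proof (intro equalityI subsetI)
  interpret real_distribution "density lborel (\<lambda>x. ennreal (p x))"
    by (rule smooth_pos_density_real_distribution[OF p])
  have bounds: "0 \<le> density_cdf p x" "density_cdf p x \<le> 1" for x
    by (auto simp: density_cdf_def cdf_nonneg cdf_bounded_prob)
  fix y assume "y \<in> range (density_cdf p)"
  then obtain x where "y = density_cdf p x" by auto
  \<comment> \<open>Comparison with the neighbours \<open>x - 1\<close> and \<open>x + 1\<close>
    makes the weak bounds strict.\<close>
  then show "y \<in> {0<..<1}"
    using bounds(1)[of "x - 1"] bounds(2)[of "x + 1"]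
      density_cdf_strict_mono[OF p, of "x - 1" x] density_cdf_strict_mono[OF p, of x "x + 1"]
    by simp
next
  interpret real_distribution "density lborel (\<lambda>x. ennreal (p x))"
    by (rule smooth_pos_density_real_distribution[OF p])
  fix y :: real assume y: "y \<in> {0<..<1}"
  have "\<forall>\<^sub>F x in at_bot. density_cdf p x < y"
    using order_tendstoD(2)[OF cdf_lim_at_bot] y by (simp add: density_cdf_def)
  then obtain a where a: "density_cdf p a < y"
    using eventually_happens'[OF trivial_limit_at_bot_linorder] by blast
  have "\<forall>\<^sub>F x in at_top. y < density_cdf p x"
    using order_tendstoD(1)[OF cdf_lim_at_top_prob] y by (simp add: density_cdf_def)
  then obtain b where b: "y < density_cdf p b"
    using eventually_happens'[OF trivial_limit_at_top_linorder] by blast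
  have "a \<le> b" using a b density_cdf_strict_mono[OF p, of b a] by fastforce
  moreover have "isCont (density_cdf p) x" for x
    using density_cdf_has_derivative[OF p] DERIV_isCont by blast
  ultimately have "\<exists>x\<ge>a. x \<le> b \<and> density_cdf p x = y"
    using a b by (intro IVT) auto
  then show "y \<in> range (density_cdf p)" by auto
qed

lemma density_cdf_transport_map:
  assumes "p \<in> smooth_pos_densities" "q \<in> smooth_pos_densities"
  shows "density_cdf p (transport_map p q x) = density_cdf q x"
  unfolding transport_map_def
proof (rule f_inv_into_f)
  show "density_cdf q x \<in> range (density_cdf p)"
    unfolding range_density_cdf[OF assms(1)] range_density_cdf[OF assms(2), symmetric] by (rule rangeI)
qed

text \<open>The equation \<open>p(T) T' = q\<close>, from the inverse function rule and the chain
  rule. It identifies \<open>1 / T'\<close> with the density ratio and makes \<open>T\<close>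
  continuous.\<close>

lemma transport_map_has_derivative:
  assumes p: "p \<in> smooth_pos_densities" and q: "q \<in> smooth_pos_densities"
  shows "(transport_map p q has_real_derivative q x / p (transport_map p q x)) (at x)"
proof -
  let ?G = "inv (density_cdf p)" and ?y = "density_cdf q x"
  have inj: "inj (density_cdf p)"
    using density_cdf_strict_mono[OF p] by (metis linorder_injI less_irrefl)
  have p_pos: "0 < p z" for z using p by (simp add: smooth_pos_densities_def)
  have y: "?y \<in> {0<..<1}" using range_density_cdf[OF q] by blast
  have Gy: "density_cdf p (?G z) = z" if "0 < z" "z < 1" for z
    using range_density_cdf[OF p] that by (intro f_inv_into_f) auto
  have "isCont ?G (density_cdf p (?G ?y))"
  proof (rule isCont_inverse_function[where d=1 and f="density_cdf p" and g="?G" and x="?G ?y"])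
    show "?G (density_cdf p z) = z" for z by (rule inv_f_f[OF inj])
    show "isCont (density_cdf p) z" for z
      by (rule DERIV_isCont[OF density_cdf_has_derivative[OF p]])
  qed simp
  then have cont: "isCont ?G ?y" using Gy[of ?y] y by simp
  have "(?G has_real_derivative inverse (p (?G ?y))) (at ?y)"
  proof (rule DERIV_inverse_function[where f="density_cdf p" and g="?G" and x="?y" and a=0 and b=1])
    show "(density_cdf p has_real_derivative p (?G ?y)) (at (?G ?y))"
      by (rule density_cdf_has_derivative[OF p])
    show "p (?G ?y) \<noteq> 0" using p_pos[of "?G ?y"] by linarith
  qed (use y Gy cont in simp_all)
  from DERIV_chain2[OF this density_cdf_has_derivative[OF q]]
  show ?thesis
    unfolding transport_map_def[abs_def] by (simp add: divide_inverse mult.commute)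
qed

section \<open>Near-optimal dual variables and exhaustion by intervals\<close>

text \<open>The dual variable is a chord slope of \<open>g\<close> times a cutoff. As the conjugate vanishes
  at \<open>0\<close>, convexity lets the cutoff be pulled out of it, and the conjugate stays finite on the
  support of the cutoff.\<close>

lemma dual_approximation:
  fixes g w q :: "real \<Rightarrow> real"
  assumes g: "convex_on {0<..} g" and g0: "\<And>u. 0 < u \<Longrightarrow> 0 \<le> g u" and g1: "g 1 = 0"
    and w: "continuous_on UNIV w" "\<And>x. 0 < w x"
    and q: "continuous_on UNIV q" "\<And>x. 0 < q x"
    and e: "0 < e"
  obtains \<Psi> B where "continuous_on UNIV \<Psi>"
    and "\<And>x. conjugate (ext_by_infinity g) (\<Psi> x) = ereal (B x)"
    and "integrable lborel (\<lambda>x. \<Psi> x * (w x * q x))" "integrable lborel (\<lambda>x. B x * q x)"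
    and "\<And>x. indicator {-N..N} x * g (w x) - e \<le> \<Psi> x * w x - B x"
proof -
  \<comment> \<open>\<open>K\<close> leaves a margin of 1 around the interval on which the cutoff
    equals 1; the absolute value keeps it nonempty for every \<open>N\<close>.\<close>
  define K where "K = {-\<bar>N\<bar> - 1..\<bar>N\<bar> + 1}"
  have K: "compact K" "K \<noteq> {}" by (auto simp: K_def)
  obtain xa where xa: "\<And>x. x \<in> K \<Longrightarrow> w xa \<le> w x"
    using continuous_attains_inf[OF K] continuous_on_subset[OF w(1)] by blast
  obtain xb where xb: "\<And>x. x \<in> K \<Longrightarrow> w x \<le> w xb"
    using continuous_attains_sup[OF K] continuous_on_subset[OF w(1)] by blast
  \<comment> \<open>Contains every chord interval from \<open>w x\<close> to \<open>w x + d\<close>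
    with \<open>x\<close> in \<open>K\<close>; the extra 1 matches \<open>d \<le> 1\<close>, so one
    modulus of continuity of \<open>g\<close> serves all of them.\<close>
  define I where "I = {w xa..w xb + 1}"
  have cont_g: "continuous_on {0<..} g" by (rule convex_on_continuous[OF _ g]) simp
  have "uniformly_continuous_on I g"
    by (rule compact_uniformly_continuous[OF continuous_on_subset[OF cont_g]])
       (use w(2)[of xa] in \<open>auto simp: I_def\<close>)
  then obtain d0 where d0: "0 < d0"
    and unif: "\<And>u v. u \<in> I \<Longrightarrow> v \<in> I \<Longrightarrow> \<bar>v - u\<bar> < d0 \<Longrightarrow> \<bar>g v - g u\<bar> < e"
    using e unfolding uniformly_continuous_on_def dist_real_def by metis
  define d where "d = min 1 (d0 / 2)"
  have d: "0 < d" "d \<le> 1" "d < d0" using d0 by (auto simp: d_def)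
  define s where "s x = (g (w x + d) - g (w x)) / d" for x
  define k where "k x = s x * w x - g (w x) + e" for x
  define cut where "cut x = max 0 (min 1 (\<bar>N\<bar> + 1 - \<bar>x\<bar>))" for x :: real
  define \<Psi> where "\<Psi> x = cut x * s x" for x
  define B where "B x = real_of_ereal (conjugate (ext_by_infinity g) (\<Psi> x))" for x

  have cut: "0 \<le> cut x" "cut x \<le> 1" "indicator {-N..N} x \<le> cut x" "x \<notin> K \<Longrightarrow> cut x = 0" for x
    by (auto simp: cut_def K_def indicator_def)
  have cont_gw: "continuous_on UNIV (\<lambda>x. g (w x + t))" if "0 \<le> t" for t
    using w(2) that
    by (intro continuous_on_compose2[OF cont_g] continuous_intros w(1)) (auto simp: add_pos_nonneg)
  have cont_s: "continuous_on UNIV s"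
    unfolding s_def using cont_gw[of d] cont_gw[of 0] d by (intro continuous_intros) auto
  have cont_cut: "continuous_on UNIV cut"
    unfolding cut_def by (intro continuous_intros)
  have cont_k: "continuous_on UNIV k"
    unfolding k_def using cont_s w(1) cont_gw[of 0] by (intro continuous_intros) auto
  have cont_\<Psi>: "continuous_on UNIV \<Psi>"
    unfolding \<Psi>_def by (intro continuous_intros cont_s cont_cut)
  have integrable_cut: "integrable lborel (\<lambda>x. cut x * F x)" if F: "continuous_on UNIV F" for F :: "real \<Rightarrow> real"
  proof -
    have "integrable lborel (\<lambda>x. indicator K x *\<^sub>R (cut x * F x))"
      by (rule borel_integrable_compact[OF K(1)])
         (intro continuous_intros continuous_on_subset[OF cont_cut] continuous_on_subset[OF F] subset_UNIV)
    also have "(\<lambda>x. indicator K x *\<^sub>R (cut x * F x)) = (\<lambda>x. cut x * F x)"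
      using cut(4) by (auto simp: indicator_def fun_eq_iff)
    finally show ?thesis .
  qed

  have upper: "conjugate (ext_by_infinity g) (\<Psi> x) \<le> ereal (cut x * k x)" for x
  proof (cases "x \<in> K")
    case True
    have "w x \<in> I" "\<And>u. w x \<le> u \<Longrightarrow> u \<le> w x + d \<Longrightarrow> u \<in> I"
      using xa[OF True] xb[OF True] d by (auto simp: I_def)
    then have "g (w x) \<le> g u + e \<and> g (w x + d) \<le> g u + e" if "w x \<le> u" "u \<le> w x + d" for u
      using unif[of u "w x"] unif[of u "w x + d"] that d by force
    then have "conjugate (ext_by_infinity g) (s x) \<le> ereal (k x)"
      unfolding s_def k_def by (rule conjugate_chord_slope[OF g w(2) d(1)])
    then show ?thesis unfolding \<Psi>_def by (rule conjugate_scale[rotated 3]) (use g0 cut in auto)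
  next
    case False
    then show ?thesis
      using conjugate_ext_least[of 0 g 0] g0 cut(4) by (simp add: \<Psi>_def)
  qed
  \<comment> \<open>The point \<open>u = 1\<close>, where \<open>g\<close> vanishes. With
    \<open>upper\<close> this makes the conjugate finite and traps it between two continuous
    functions of compact support.\<close>
  have lower: "ereal (\<Psi> x) \<le> conjugate (ext_by_infinity g) (\<Psi> x)" for x
    using conjugate_ext_upper[of 1 "\<Psi> x" g] g1 by simp
  have B: "conjugate (ext_by_infinity g) (\<Psi> x) = ereal (B x)" for x
    unfolding B_def using upper[of x] lower[of x]
    by (cases "conjugate (ext_by_infinity g) (\<Psi> x)") auto
  have B_le: "B x \<le> cut x * k x" and B_ge: "cut x * s x \<le> B x" for x
    using upper[of x] lower[of x] unfolding B by (simp_all add: \<Psi>_def)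

  show ?thesis
  proof (rule that[OF cont_\<Psi> B])
    show "integrable lborel (\<lambda>x. \<Psi> x * (w x * q x))"
      unfolding \<Psi>_def mult.assoc by (intro integrable_cut continuous_intros cont_s w q)
    have [measurable]: "\<Psi> \<in> borel_measurable borel" "q \<in> borel_measurable borel"
      using cont_\<Psi> q(1) by (auto intro: borel_measurable_continuous_onI)
    show "integrable lborel (\<lambda>x. B x * q x)"
    \<comment> \<open>\<open>B\<close> is known only to be measurable, so it is dominated by a
      continuous function times the cutoff.\<close>
    proof (rule Bochner_Integration.integrable_bound)
      show "integrable lborel (\<lambda>x. cut x * ((\<bar>k x\<bar> + \<bar>s x\<bar>) * q x))"
        by (intro integrable_cut continuous_intros cont_s cont_k q)
      show "(\<lambda>x. B x * q x) \<in> borel_measurable lborel"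
        unfolding B_def by measurable
      have "\<bar>B x\<bar> \<le> cut x * (\<bar>k x\<bar> + \<bar>s x\<bar>)" for x
      proof -
        have "cut x * k x \<le> cut x * \<bar>k x\<bar>" "cut x * - \<bar>s x\<bar> \<le> cut x * s x"
          "0 \<le> cut x * \<bar>k x\<bar>" "0 \<le> cut x * \<bar>s x\<bar>"
          using cut(1)[of x] by (intro mult_left_mono mult_nonneg_nonneg; simp)+
        then show ?thesis using B_le[of x] B_ge[of x] by (simp add: algebra_simps)
      qed
      then have "\<bar>B x\<bar> * q x \<le> cut x * (\<bar>k x\<bar> + \<bar>s x\<bar>) * q x" for x
        using q(2) by (intro mult_right_mono) (auto simp: less_imp_le)
      moreover have "norm (B x * q x) = \<bar>B x\<bar> * q x"
        "norm (cut x * ((\<bar>k x\<bar> + \<bar>s x\<bar>) * q x)) = cut x * (\<bar>k x\<bar> + \<bar>s x\<bar>) * q x" for x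
        using q(2)[of x] cut(1)[of x] by (simp_all add: abs_mult)
      ultimately show "AE x in lborel. norm (B x * q x) \<le> norm (cut x * ((\<bar>k x\<bar> + \<bar>s x\<bar>) * q x))"
        by simp
    qed
    fix x
    \<comment> \<open>The cutoff lies between the indicator and 1: as \<open>g \<ge> 0\<close> the
      gain does not fall below the indicator term, and the loss \<open>cut x * e\<close> is at most
      \<open>e\<close>.\<close>
    have "indicator {-N..N} x * g (w x) - e \<le> cut x * g (w x) - cut x * e"
      using cut[of x] g0[OF w(2)] e
      by (intro diff_mono mult_right_mono mult_left_le_one_le) auto
    also have "\<dots> = \<Psi> x * w x - cut x * k x"
      by (simp add: \<Psi>_def k_def algebra_simps)
    also have "\<dots> \<le> \<Psi> x * w x - B x" using B_le[of x] by simp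
    finally show "indicator {-N..N} x * g (w x) - e \<le> \<Psi> x * w x - B x" .
  qed
qed

text \<open>Monotone convergence; the limit may be infinite, so an infinite divergence is covered
  too.\<close>

lemma nn_integral_le_of_intervals:
  fixes F :: "real \<Rightarrow> real"
  assumes F: "F \<in> borel_measurable borel" "\<And>x. 0 \<le> F x"
    and le: "\<And>n::nat. (\<integral>\<^sup>+x. ennreal (indicator {-real n..real n} x * F x) \<partial>lborel) \<le> c"
  shows "(\<integral>\<^sup>+x. ennreal (F x) \<partial>lborel) \<le> c"
proof (rule LIMSEQ_le_const2)
  note F(1) [measurable]
  show "(\<lambda>n. \<integral>\<^sup>+x. ennreal (indicator {-real n..real n} x * F x) \<partial>lborel)
      \<longlonglongrightarrow> (\<integral>\<^sup>+x. ennreal (F x) \<partial>lborel)"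
  proof (rule nn_integral_LIMSEQ)
    show "incseq (\<lambda>n x. ennreal (indicator {-real n..real n} x * F x))"
      using F(2) by (intro incseq_SucI le_funI ennreal_leI) (auto simp: indicator_def)
    fix x
    have "\<forall>\<^sub>F n in sequentially. ennreal (indicator {-real n..real n} x * F x) = ennreal (F x)"
      using eventually_ge_at_top[of "nat \<lceil>\<bar>x\<bar>\<rceil>"]
      by eventually_elim (auto simp: indicator_def abs_le_iff le_nat_iff nat_le_iff ceiling_le_iff)
    then show "(\<lambda>n. ennreal (indicator {-real n..real n} x * F x)) \<longlonglongrightarrow> ennreal (F x)"
      by (rule tendsto_eventually)
  qed measurable
qed (use le in blast)

section \<open>Duality and optimality for the transport divergence\<close>

text \<open>The supremum is restricted to well-defined objectives because an indeterminate
  difference would count as \<infinity>. Differentiability is asked only at the points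
  \<open>1 / T'\<close>, where the duality variable evaluates the derivative.\<close>

theorem mainTheorem3:
  fixes f p q :: "real \<Rightarrow> real"
  assumes f_nonneg: "\<And>u. 0 < u \<Longrightarrow> 0 \<le> f u"
    and f_convex: "convex_on {0<..} f"
    and f_one: "f 1 = 0"
    and p: "p \<in> smooth_pos_densities"
    and q: "q \<in> smooth_pos_densities"
    and fhat_strict: "strictly_convex_on {0<..} (fhat f)"
  shows "transport_f_divergence f p q =
           (SUP \<Psi>\<in>{\<Psi>. continuous_on UNIV \<Psi> \<and> dual_well_defined f p q \<Psi>}. dual_objective f p q \<Psi>)
       \<and> ((\<forall>x. fhat f differentiable (at (1 / deriv (transport_map p q) x))) \<longrightarrow>
           continuous_on UNIV (duality_variable f p q) \<and>
           (dual_well_defined f p q (duality_variable f p q) \<longrightarrow>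
              transport_f_divergence f p q = dual_objective f p q (duality_variable f p q)))"
proof -
  let ?T = "transport_map p q" and ?g = "fhat f" and ?gs = "fhat_conj f"
  define w where "w x = p (?T x) / q x" for x
  define D where "D x = ?g (w x) * q x" for x

  have pos: "0 < p x" "0 < q x" "0 < w x" for x
    using p q by (auto simp: smooth_pos_densities_def w_def)
  have g: "convex_on {0<..} ?g" by (rule strictly_convex_on_imp_convex_on[OF fhat_strict])
  have g0: "0 \<le> ?g u" if "0 < u" for u using f_nonneg[of "1 / u"] that by (simp add: fhat_def)
  have D0: "0 \<le> D x" for x using g0[OF pos(3)] pos(2) by (simp add: D_def less_imp_le)
  have pT: "p (?T x) = w x * q x" for x using pos(2)[of x] by (simp add: w_def)
  have T: "deriv ?T x = 1 / w x" for x
    using transport_map_has_derivative[OF p q] by (simp add: w_def DERIV_imp_deriv)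
  have divergence: "transport_f_divergence f p q = ext_integral lborel (\<lambda>x. ereal (D x))"
    by (simp add: transport_f_divergence_def D_def fhat_def w_def)

  have cont_p: "continuous_on UNIV p" and cont_q: "continuous_on UNIV q"
    using p q by (auto intro: smooth_pos_density_continuous_on)
  have cont_T: "continuous_on UNIV ?T"
    using transport_map_has_derivative[OF p q] DERIV_isCont continuous_at_imp_continuous_on by blast
  have cont_w: "continuous_on UNIV w"
    unfolding w_def using pos(2)
    by (intro continuous_intros continuous_on_compose2[OF cont_p] cont_T cont_q)
       (auto simp: less_imp_neq[THEN not_sym])
  have "continuous_on UNIV (\<lambda>x. ?g (w x))"
    by (rule continuous_on_compose2[OF convex_on_continuous[OF _ g] cont_w]) (use pos in auto)
  then have "continuous_on UNIV D"
    unfolding D_def by (intro continuous_intros cont_q)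
  then have [measurable]: "D \<in> borel_measurable borel" "w \<in> borel_measurable borel"
    "q \<in> borel_measurable borel"
    using cont_w cont_q by (auto intro: borel_measurable_continuous_onI)
  have [measurable]: "?gs \<in> borel_measurable borel"
    unfolding fhat_conj_def by (rule borel_measurable_conjugate)

  have gs_upper: "ereal (w x * v - ?g (w x)) \<le> ?gs v" for x v
    unfolding fhat_conj_def by (rule conjugate_ext_upper[OF pos(3)])
  have gs_not_minf: "?gs v * ereal (q x) \<noteq> - \<infinity>" for v x
    using gs_upper[of x v] pos(2)[of x] by (cases "?gs v") auto

  have weak: "dual_objective f p q \<Psi> \<le> ext_integral lborel (\<lambda>x. ereal (D x))"
    if \<Psi>: "continuous_on UNIV \<Psi>" "dual_well_defined f p q \<Psi>" for \<Psi>
    unfolding dual_objective_def primal_term_def conj_term_def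
  proof (rule ext_integral_diff_le)
    have [measurable]: "\<Psi> \<in> borel_measurable borel"
      using \<Psi>(1) by (rule borel_measurable_continuous_onI)
    show "(\<lambda>x. \<Psi> x * p (?T x)) \<in> borel_measurable lborel"
      "(\<lambda>x. ?gs (\<Psi> x) * ereal (q x)) \<in> borel_measurable lborel" "D \<in> borel_measurable lborel"
      unfolding pT by measurable
    fix x
    show "ereal (\<Psi> x * p (?T x)) \<le> ereal (D x) + ?gs (\<Psi> x) * ereal (q x)"
    proof (cases "?gs (\<Psi> x)")
      case (real r)
      then have "w x * \<Psi> x \<le> ?g (w x) + r" using gs_upper[of x "\<Psi> x"] by simp
      then have "w x * \<Psi> x * q x \<le> (?g (w x) + r) * q x"
        using pos(2)[of x] by (intro mult_right_mono) auto
      then show ?thesis using real by (simp add: pT D_def algebra_simps)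
    qed (use gs_upper[of x "\<Psi> x"] pos(2)[of x] in auto)
  qed (use \<Psi>(2) D0 gs_not_minf in \<open>auto simp: dual_well_defined_def primal_term_def[abs_def] conj_term_def[abs_def]\<close>)

  let ?W = "{\<Psi>. continuous_on UNIV \<Psi> \<and> dual_well_defined f p q \<Psi>}"
  let ?S = "SUP \<Psi>\<in>?W. dual_objective f p q \<Psi>"

  \<comment> \<open>A continuous function cut off to a compact interval has a finite integral, even
    if that of \<open>D\<close> is infinite.\<close>
  define D' where "D' n x = indicator {-real n..real n} x * D x" for n x
  have D'0: "0 \<le> D' n x" for n x using D0 by (simp add: D'_def)
  have int_D': "integrable lborel (D' n)" for n
    using borel_integrable_compact[of "{-real n..real n}" D] \<open>continuous_on UNIV D\<close>
    by (simp add: D'_def[abs_def] continuous_on_subset)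
  have trunc: "ereal (LINT x|lborel. D' n x) \<le> ?S" for n
  proof (rule ereal_le_epsilon2)
    fix e :: real assume e: "0 < e"
    have int_q: "integrable lborel q" "(LINT x|lborel. q x) = 1"
      using q by (auto simp: smooth_pos_densities_def)
    have g1: "?g 1 = 0" using f_one by (simp add: fhat_def)
    obtain \<Psi> B where \<Psi>: "continuous_on UNIV \<Psi>" and B: "\<And>x. ?gs (\<Psi> x) = ereal (B x)"
      and int: "integrable lborel (\<lambda>x. \<Psi> x * (w x * q x))" "integrable lborel (\<lambda>x. B x * q x)"
      and le: "\<And>x. indicator {-real n..real n} x * ?g (w x) - e \<le> \<Psi> x * w x - B x"
      using dual_approximation[OF g g0 g1 cont_w pos(3) cont_q pos(2) e, of "real n"]
      unfolding fhat_conj_def by blast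
    have prim: "primal_term p q \<Psi> = (\<lambda>x. ereal (\<Psi> x * (w x * q x)))"
      and conj: "conj_term f q \<Psi> = (\<lambda>x. ereal (B x * q x))"
      by (simp_all add: primal_term_def[abs_def] conj_term_def[abs_def] pT B)
    have wd: "dual_well_defined f p q \<Psi>"
      unfolding dual_well_defined_def prim conj
      using int by (simp add: ext_integral_integrable ext_integral_exists_integrable)
    \<comment> \<open>Since \<open>q\<close> has mass 1, the pointwise error \<open>e\<close> costs
      exactly \<open>e\<close> after integration.\<close>
    have "(LINT x|lborel. D' n x) - e = (LINT x|lborel. D' n x - e * q x)"
      using int_D' int_q by simp
    also have "\<dots> \<le> (LINT x|lborel. \<Psi> x * (w x * q x) - B x * q x)"
    proof (rule integral_mono)
      fix x
      have "(indicator {-real n..real n} x * ?g (w x) - e) * q x \<le> (\<Psi> x * w x - B x) * q x"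
        using le[of x] pos(2)[of x] by (intro mult_right_mono) auto
      then show "D' n x - e * q x \<le> \<Psi> x * (w x * q x) - B x * q x"
        by (simp add: D'_def D_def algebra_simps)
    qed (use int int_D' int_q in auto)
    finally have "ereal ((LINT x|lborel. D' n x) - e) \<le> dual_objective f p q \<Psi>"
      unfolding dual_objective_def prim conj
      using int by (simp add: ext_integral_integrable)
    also have "\<dots> \<le> ?S" using \<Psi> wd by (intro SUP_upper) simp
    finally have "ereal ((LINT x|lborel. D' n x) - e) + ereal e \<le> ?S + ereal e"
      by (rule add_right_mono)
    then show "ereal (LINT x|lborel. D' n x) \<le> ?S + ereal e" by simp
  qed
  \<comment> \<open>\<open>e2ennreal\<close> sends negative values to 0, so nonnegativity is what
    lets \<open>?S\<close> survive the passage through \<open>ennreal\<close> and back.\<close>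
  have S0: "0 \<le> ?S"
    using order_trans[OF _ trunc[of 0]] D'0 by (simp add: integral_nonneg)
  have strong: "ext_integral lborel (\<lambda>x. ereal (D x)) \<le> ?S"
  proof -
    have "(\<integral>\<^sup>+x. ennreal (D' n x) \<partial>lborel) \<le> e2ennreal ?S" for n
      using e2ennreal_mono[OF trunc[of n]] nn_integral_eq_integral[OF int_D'] D'0 by simp
    then have "(\<integral>\<^sup>+x. ennreal (D x) \<partial>lborel) \<le> e2ennreal ?S"
      unfolding D'_def by (rule nn_integral_le_of_intervals[rotated 2]) (use D0 in simp_all)
    then have "enn2ereal (\<integral>\<^sup>+x. ennreal (D x) \<partial>lborel) \<le> enn2ereal (e2ennreal ?S)"
      by (simp add: less_eq_ennreal.rep_eq)
    then show ?thesis using S0 by (simp add: ext_integral_nonneg[OF D0] enn2ereal_e2ennreal)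
  qed
  have duality: "transport_f_divergence f p q = ?S"
    unfolding divergence by (intro antisym strong SUP_least weak) auto

  have opt: "continuous_on UNIV (duality_variable f p q) \<and>
      (dual_well_defined f p q (duality_variable f p q) \<longrightarrow>
        transport_f_divergence f p q = dual_objective f p q (duality_variable f p q))"
    if diff: "\<forall>x. ?g differentiable (at (1 / deriv ?T x))"
  proof (intro conjI impI)
    let ?\<Psi> = "duality_variable f p q"
    have diff_w: "?g differentiable (at (w x))" for x using diff by (simp add: T)
    have \<Psi>: "?\<Psi> = (\<lambda>x. deriv ?g (w x))" by (simp add: duality_variable_def[abs_def] T)
    \<comment> \<open>Continuity on the range of \<open>w\<close> suffices for the composition, and
      differentiability is assumed only there.\<close>
    have "continuous_on (range w) (deriv ?g)"
      by (rule convex_on_continuous_on_deriv[OF g]) (use pos diff_w in auto)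
    then show cont: "continuous_on UNIV ?\<Psi>"
      unfolding \<Psi> by (rule continuous_on_compose2[OF _ cont_w]) simp
    assume wd: "dual_well_defined f p q ?\<Psi>"
    \<comment> \<open>Only this direction uses the equality case; the reverse is weak duality at
      this particular \<Psi>, now known to be continuous.\<close>
    have "ext_integral lborel (\<lambda>x. ereal (D x)) \<le> dual_objective f p q ?\<Psi>"
      unfolding dual_objective_def primal_term_def conj_term_def
    proof (rule ext_integral_diff_ge)
      have [measurable]: "?\<Psi> \<in> borel_measurable borel"
        using cont by (rule borel_measurable_continuous_onI)
      show "(\<lambda>x. ?\<Psi> x * p (?T x)) \<in> borel_measurable lborel"
        "(\<lambda>x. ?gs (?\<Psi> x) * ereal (q x)) \<in> borel_measurable lborel" "D \<in> borel_measurable lborel"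
        unfolding pT by measurable
      fix x
      have "?gs (?\<Psi> x) = ereal (w x * ?\<Psi> x - ?g (w x))"
        unfolding \<Psi> fhat_conj_def by (rule conjugate_at_deriv[OF g pos(3) diff_w])
      then show "ereal (D x) + ?gs (?\<Psi> x) * ereal (q x) \<le> ereal (?\<Psi> x * p (?T x))"
        by (simp add: pT D_def algebra_simps)
    qed (use wd D0 gs_not_minf in \<open>auto simp: dual_well_defined_def primal_term_def[abs_def] conj_term_def[abs_def]\<close>)
    then show "transport_f_divergence f p q = dual_objective f p q ?\<Psi>"
      unfolding divergence using weak[OF cont wd] by (rule antisym)
  qed
  show ?thesis using duality opt by blast
qed

end
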